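(* Let $d \geq 2$ and let $A = (a_{i_1 \ldots i_d})$ be a $d$-dimensional $n \times \cdots \times n$ complex tensor such that $$\sum_{1 \leq i_2, \ldots, i_d \leq n} |a_{i i_2 \ldots i_d}| < 1 \quad \text{for } i = 1, \ldots, n.$$ Then $\operatorname{PER}(I + A) \neq 0$, where $I$ is the $d$-dimensional $n \times \cdots \times n$ tensor with diagonal entries $I_{i\ldots i}=1$ for $i=1,\ldots,n$ and all other entries equal to $0$.
   Context: For a $d$-dimensional $n\times\cdots\times n$ complex tensor $B=(b_{i_1\ldots i_d})$, its permanent is $\operatorname{PER} B = \sum_{\sigma_2, \ldots, \sigma_d \in S_n} \prod_{i=1}^n b_{i\,\sigma_2(i) \ldots \sigma_d(i)}$, where $S_n$ is the symmetric group on $\{1,\ldots,n\}$. *)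

theory Defs
  imports Complex_Main "HOL-Combinatorics.Permutations"
begin

text \<open>
  A \<open>d\<close>-dimensional \<open>n \<times> \<dots> \<times> n\<close> complex tensor is a function on multi-indices
  \<open>[i\<^sub>1, \<dots>, i\<^sub>d]\<close>; only its values on lists of length \<open>d\<close> with entries in \<open>{1..n}\<close> are
  relevant.
\<close>

type_synonym tensor = "nat list \<Rightarrow> complex"

definition multi_indices :: "nat \<Rightarrow> nat \<Rightarrow> nat list set" where
  "multi_indices n k = {js. length js = k \<and> set js \<subseteq> {1..n}}"

definition perm_tuples :: "nat \<Rightarrow> nat \<Rightarrow> (nat \<Rightarrow> nat) list set" where
  "perm_tuples n k = {\<sigma>s. length \<sigma>s = k \<and> (\<forall>\<sigma>\<in>set \<sigma>s. \<sigma> permutes {1..n})}"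

text \<open>The list \<open>\<sigma>s\<close> below is \<open>[\<sigma>\<^sub>2, \<dots>, \<sigma>\<^sub>d]\<close>.\<close>

definition PER :: "nat \<Rightarrow> nat \<Rightarrow> tensor \<Rightarrow> complex" where
  "PER d n B = (\<Sum>\<sigma>s\<in>perm_tuples n (d - 1). \<Prod>i=1..n. B (i # map (\<lambda>\<sigma>. \<sigma> i) \<sigma>s))"

definition diag_tensor :: "nat \<Rightarrow> nat \<Rightarrow> tensor" where
  "diag_tensor d n js = (if \<exists>i\<in>{1..n}. js = replicate d i then 1 else 0)"

end

theory Submission
  imports Defs "HOL-Computational_Algebra.Fundamental_Theorem_Algebra"
begin

text \<open>
  Induction on \<open>n\<close>. Fix a row \<open>v\<close> and let \<open>N\<^sub>J\<close> be the permanent after replacing row \<open>v\<close> by the unit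
  row \<open>e\<^sub>J\<close>, \<open>J = (j\<^sub>2, \<dots>, j\<^sub>d)\<close>. Then \<open>PER (I + A) = N\<^sub>(\<^sub>v\<^sub>,\<^sub>\<dots>\<^sub>,\<^sub>v\<^sub>) + \<Sum>\<^sub>J a\<^sub>v\<^sub>J N\<^sub>J\<close>, so it suffices
  that \<open>|N\<^sub>J| \<le> |N\<^sub>(\<^sub>v\<^sub>,\<^sub>\<dots>\<^sub>,\<^sub>v\<^sub>)| \<noteq> 0\<close>. For a complex number \<open>z\<close>, delete row \<open>v\<close> and, in every direction
  \<open>t\<close> with \<open>j\<^sub>t \<noteq> v\<close>, add \<open>z\<close> times slice \<open>v\<close> to slice \<open>j\<^sub>t\<close> before deleting slice \<open>v\<close>. The permanent
  of the smaller tensor is a polynomial in \<open>z\<close> with constant term \<open>N\<^sub>(\<^sub>v\<^sub>,\<^sub>\<dots>\<^sub>,\<^sub>v\<^sub>)\<close> and top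
  coefficient \<open>N\<^sub>J\<close>. For \<open>|z| \<le> 1\<close> the smaller tensor again satisfies the hypothesis, so by induction
  all roots of this polynomial lie outside the unit disc, and its top coefficient is at most its
  constant term in modulus.
\<close>

section \<open>Polynomials without roots in the closed unit disc\<close>

text \<open>Up to sign, the constant coefficient is the leading one times the product of the roots,
  all of modulus above 1; the proof splits off one root at a time. If \<open>degree p < k\<close>,
  the left side is 0.\<close>

lemma norm_coeff_le_norm_constant_coeff:
  fixes p :: "complex poly"
  assumes "\<And>z. norm z \<le> 1 \<Longrightarrow> poly p z \<noteq> 0" and "degree p \<le> k"
  shows "norm (coeff p k) \<le> norm (coeff p 0)"
  using assms
proof (induction k arbitrary: p)
  case 0
  then show ?case by simp
next
  case (Suc k)
  show ?case
  proof (cases "degree p = Suc k")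
    case False
    then have "coeff p (Suc k) = 0"
      using Suc.prems(2) by (intro coeff_eq_0) simp
    then show ?thesis by simp
  next
    case True
    then have "\<not> constant (poly p)"
      by (simp add: constant_degree)
    then obtain a where a: "poly p a = 0"
      using fundamental_theorem_of_algebra by blast
    then obtain q where q: "p = [:- a, 1:] * q"
      by (auto simp: poly_eq_0_iff_dvd elim: dvdE)
    have a1: "norm a > 1"
      using a Suc.prems(1) by force
    have "q \<noteq> 0"
      using True q by auto
    then have "degree p = Suc (degree q)"
      unfolding q by (subst degree_mult_eq) auto
    then have dq: "degree q \<le> k"
      using True by simp
    have "poly q z \<noteq> 0" if "norm z \<le> 1" for z
      using Suc.prems(1)[OF that] by (auto simp: q)
    then have IH: "norm (coeff q k) \<le> norm (coeff q 0)"
      using dq by (rule Suc.IH)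
    have "coeff p (Suc k) = coeff q k"
      using dq by (simp add: q coeff_eq_0)
    moreover have "norm (coeff p 0) = norm a * norm (coeff q 0)"
      by (simp add: q norm_mult)
    moreover have "1 * norm (coeff q 0) \<le> norm a * norm (coeff q 0)"
      using a1 by (intro mult_right_mono) auto
    ultimately show ?thesis using IH by simp
  qed
qed

section \<open>Permanents over arbitrary index sets\<close>

definition tuples :: "'a set \<Rightarrow> nat \<Rightarrow> 'a list set" where
  "tuples X m = {xs. set xs \<subseteq> X \<and> length xs = m}"

lemma tuples_0 [simp]: "tuples X 0 = {[]}"
  by (auto simp: tuples_def)

lemma tuples_Suc: "tuples X (Suc m) = (\<lambda>(x, xs). x # xs) ` (X \<times> tuples X m)"
  by (auto simp: tuples_def length_Suc_conv image_iff)

lemma finite_tuples [simp]: "finite X \<Longrightarrow> finite (tuples X m)"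
  by (simp add: tuples_def finite_lists_length_eq)

lemma sum_tuples_Suc:
  "(\<Sum>xs\<in>tuples X (Suc m). f xs) = (\<Sum>x\<in>X. \<Sum>xs\<in>tuples X m. f (x # xs))"
  unfolding tuples_Suc sum.cartesian_product
  by (subst sum.reindex) (auto simp: inj_on_def case_prod_unfold)

text \<open>An arbitrary index set \<open>S\<close> allows an index to be deleted without
  renumbering. The row index is kept apart from the other \<open>m\<close> directions, which can
  then be peeled off one by one.\<close>

definition tensor_per :: "nat set \<Rightarrow> nat \<Rightarrow> (nat \<Rightarrow> nat list \<Rightarrow> complex) \<Rightarrow> complex" where
  "tensor_per S m B = (\<Sum>\<sigma>s\<in>tuples {\<sigma>. \<sigma> permutes S} m. \<Prod>i\<in>S. B i (map (\<lambda>\<sigma>. \<sigma> i) \<sigma>s))"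

lemma PER_eq_tensor_per: "PER d n B = tensor_per {1..n} (d - 1) (\<lambda>i L. B (i # L))"
proof -
  have "perm_tuples n (d - 1) = tuples {\<sigma>. \<sigma> permutes {1..n}} (d - 1)"
    by (auto simp: perm_tuples_def tuples_def)
  then show ?thesis by (simp add: PER_def tensor_per_def)
qed

lemma tensor_per_0: "tensor_per S 0 B = (\<Prod>i\<in>S. B i [])"
  by (simp add: tensor_per_def)

lemma tensor_per_Suc:
  "tensor_per S (Suc m) B = (\<Sum>\<sigma> | \<sigma> permutes S. tensor_per S m (\<lambda>i L. B i (\<sigma> i # L)))"
  by (simp add: tensor_per_def sum_tuples_Suc)

lemma tensor_per_cong:
  assumes "\<And>i L. i \<in> S \<Longrightarrow> L \<in> tuples S m \<Longrightarrow> B i L = C i L"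
  shows "tensor_per S m B = tensor_per S m C"
  unfolding tensor_per_def
proof (intro sum.cong prod.cong refl)
  fix \<sigma>s i assume \<sigma>s: "\<sigma>s \<in> tuples {\<sigma>. \<sigma> permutes S} m" and i: "i \<in> S"
  then have "map (\<lambda>\<sigma>. \<sigma> i) \<sigma>s \<in> tuples S m"
    by (auto simp: tuples_def permutes_in_image)
  then show "B i (map (\<lambda>\<sigma>. \<sigma> i) \<sigma>s) = C i (map (\<lambda>\<sigma>. \<sigma> i) \<sigma>s)"
    using assms i by blast
qed

text \<open>Every product in the permanent has exactly one factor from row \<open>u\<close>.\<close>

lemma tensor_per_row_linear:
  assumes "finite S" and "u \<in> S"
    and "\<And>L. B u L = B1 u L + z * B2 u L"
    and "\<And>i L. i \<in> S \<Longrightarrow> i \<noteq> u \<Longrightarrow> B1 i L = B i L"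
    and "\<And>i L. i \<in> S \<Longrightarrow> i \<noteq> u \<Longrightarrow> B2 i L = B i L"
  shows "tensor_per S m B = tensor_per S m B1 + z * tensor_per S m B2"
proof -
  have "(\<Prod>i\<in>S. B i (g i)) = (\<Prod>i\<in>S. B1 i (g i)) + z * (\<Prod>i\<in>S. B2 i (g i))" for g
  proof -
    have "(\<Prod>i\<in>S-{u}. B1 i (g i)) = (\<Prod>i\<in>S-{u}. B i (g i))"
      "(\<Prod>i\<in>S-{u}. B2 i (g i)) = (\<Prod>i\<in>S-{u}. B i (g i))"
      using assms by (auto intro!: prod.cong)
    then show ?thesis
      using assms(1-3) by (simp add: prod.remove[of S u] algebra_simps)
  qed
  then show ?thesis
    by (simp add: tensor_per_def sum.distrib sum_distrib_left)
qed

text \<open>Laplace expansion along row \<open>v\<close>. A permutation of \<open>insert v S\<close>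
  is uniquely \<open>transpose v j \<circ> \<tau>\<close> with \<open>\<tau>\<close> permuting
  \<open>S\<close>. In the minor for \<open>J\<close>, slice \<open>J ! t\<close> is deleted in each
  direction \<open>t\<close> and slice \<open>v\<close> takes its place.\<close>

lemma tensor_per_row_expansion:
  assumes "finite S" and "v \<notin> S"
  shows "tensor_per (insert v S) m B =
    (\<Sum>J\<in>tuples (insert v S) m. B v J * tensor_per S m (\<lambda>i L. B i (map2 (transpose v) J L)))"
proof (induction m arbitrary: B)
  case 0
  then show ?case using assms by (simp add: tensor_per_0)
next
  case (Suc m)
  let ?T = "insert v S"
  have *: "tensor_per ?T m (\<lambda>i L. B i ((transpose v j \<circ> \<tau>) i # L)) =
      (\<Sum>J\<in>tuples ?T m. B v (j # J) *
        tensor_per S m (\<lambda>i L. B i (transpose v j (\<tau> i) # map2 (transpose v) J L)))"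
    if "\<tau> permutes S" for j \<tau>
    \<comment> \<open>\<open>\<tau>\<close> fixes \<open>v\<close>, so the first column index of row
      \<open>v\<close> is \<open>j\<close>.\<close>
    using permutes_not_in[OF that assms(2)] by (simp add: Suc.IH)
  have "tensor_per ?T (Suc m) B = (\<Sum>j\<in>?T. \<Sum>\<tau> | \<tau> permutes S.
      tensor_per ?T m (\<lambda>i L. B i ((transpose v j \<circ> \<tau>) i # L)))"
    unfolding tensor_per_Suc by (rule sum_over_permutations_insert[OF assms])
  also have "\<dots> = (\<Sum>j\<in>?T. \<Sum>\<tau> | \<tau> permutes S. \<Sum>J\<in>tuples ?T m. B v (j # J) *
        tensor_per S m (\<lambda>i L. B i (transpose v j (\<tau> i) # map2 (transpose v) J L)))"
    using * by (intro sum.cong refl) simp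
  also have "\<dots> = (\<Sum>j\<in>?T. \<Sum>J\<in>tuples ?T m. \<Sum>\<tau> | \<tau> permutes S. B v (j # J) *
        tensor_per S m (\<lambda>i L. B i (transpose v j (\<tau> i) # map2 (transpose v) J L)))"
    by (intro sum.cong refl sum.swap)
  finally show ?case
    by (simp add: sum_tuples_Suc tensor_per_Suc sum_distrib_left)
qed

section \<open>Merging slices\<close>

text \<open>In each direction \<open>t\<close> with \<open>J ! t \<noteq> v\<close>, add \<open>z\<close> times slice \<open>v\<close> to slice \<open>J ! t\<close>.\<close>

fun merge_slices :: "nat \<Rightarrow> complex \<Rightarrow> nat list \<Rightarrow> (nat list \<Rightarrow> complex) \<Rightarrow> nat list \<Rightarrow> complex" where
  "merge_slices v z [] f L = f L"
| "merge_slices v z (j # J) f [] = 0"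
| "merge_slices v z (j # J) f (l # L) = merge_slices v z J (\<lambda>K. f (l # K)) L +
    (if l = j \<and> j \<noteq> v then z * merge_slices v z J (\<lambda>K. f (v # K)) L else 0)"

lemma merge_slices_add:
  "merge_slices v z J (\<lambda>L. f L + g L) L = merge_slices v z J f L + merge_slices v z J g L"
proof (induction J arbitrary: f g L)
  case (Cons j J)
  then show ?case by (cases L) (auto simp: algebra_simps)
qed simp

lemma merge_slices_zero [simp]: "merge_slices v z J (\<lambda>L. 0) L = 0"
proof (induction J arbitrary: L)
  case (Cons j J)
  then show ?case by (cases L) auto
qed simp

text \<open>The added terms read the unit row at lists containing \<open>v\<close>, where it
  vanishes because \<open>i \<noteq> v\<close>. Hence merging preserves the diagonal part of the
  tensor.\<close>

lemma merge_slices_diagonal: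
  assumes "i \<noteq> v" and "length L = length J"
  shows "merge_slices v z J (\<lambda>L. of_bool (L = replicate (length J) i)) L
    = of_bool (L = replicate (length J) i)"
  using assms(2)
proof (induction J arbitrary: L)
  case (Cons j J)
  then obtain l K where L: "L = l # K" "length K = length J"
    by (cases L) auto
  show ?case
    using Cons.IH[OF L(2)] assms(1) by (cases "l = i") (auto simp: L(1))
qed simp

text \<open>By the triangle inequality: each entry of \<open>f\<close> enters at most one merged
  entry, with a power of \<open>z\<close> as its factor.\<close>

lemma sum_norm_merge_slices_le:
  assumes "finite S" and "v \<notin> S" and "norm z \<le> 1"
  shows "(\<Sum>L\<in>tuples S (length J). norm (merge_slices v z J f L))
    \<le> (\<Sum>L\<in>tuples (insert v S) (length J). norm (f L))"
proof (induction J arbitrary: f)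
  case Nil
  then show ?case by simp
next
  case (Cons j J)
  let ?m = "length J"
  define G where "G l = (\<Sum>L\<in>tuples S ?m. norm (merge_slices v z J (\<lambda>K. f (l # K)) L))" for l
  define H where "H l = (\<Sum>L\<in>tuples (insert v S) ?m. norm (f (l # L)))" for l
  have GH: "G l \<le> H l" for l
    unfolding G_def H_def by (rule Cons.IH)
  \<comment> \<open>This covers \<open>j \<notin> S\<close>, where no slice of \<open>S\<close>
    receives slice \<open>v\<close>.\<close>
  have G0: "G v \<ge> 0"
    unfolding G_def by (intro sum_nonneg) auto
  have "(\<Sum>L\<in>tuples S ?m. norm (merge_slices v z (j # J) f (l # L)))
      \<le> G l + (if l = j then G v else 0)" for l
  proof -
    have "norm (merge_slices v z (j # J) f (l # L)) \<le> norm (merge_slices v z J (\<lambda>K. f (l # K)) L)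
        + (if l = j then norm (merge_slices v z J (\<lambda>K. f (v # K)) L) else 0)" for L
    proof -
      have "norm (z * merge_slices v z J (\<lambda>K. f (v # K)) L)
          \<le> norm (merge_slices v z J (\<lambda>K. f (v # K)) L)"
        using assms(3) by (simp add: norm_mult mult_left_le_one_le)
      then show ?thesis
        by (auto intro: order_trans[OF norm_triangle_ineq])
    qed
    then have "(\<Sum>L\<in>tuples S ?m. norm (merge_slices v z (j # J) f (l # L)))
        \<le> (\<Sum>L\<in>tuples S ?m. norm (merge_slices v z J (\<lambda>K. f (l # K)) L)
        + (if l = j then norm (merge_slices v z J (\<lambda>K. f (v # K)) L) else 0))"
      by (rule sum_mono)
    also have "\<dots> = G l + (if l = j then G v else 0)"
      by (simp add: G_def sum.distrib)
    finally show ?thesis .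
  qed
  then have "(\<Sum>L\<in>tuples S (length (j # J)). norm (merge_slices v z (j # J) f L))
      \<le> (\<Sum>l\<in>S. G l + (if l = j then G v else 0))"
    unfolding length_Cons sum_tuples_Suc by (intro sum_mono)
  also have "\<dots> \<le> (\<Sum>l\<in>S. G l) + G v"
    using assms(1) G0 by (simp add: sum.distrib)
  also have "\<dots> \<le> (\<Sum>l\<in>S. H l) + H v"
    by (intro add_mono sum_mono GH)
  also have "\<dots> = (\<Sum>L\<in>tuples (insert v S) (length (j # J)). norm (f L))"
    using assms(1,2) by (simp add: sum_tuples_Suc H_def)
  finally show ?case .
qed

text \<open>Each direction with \<open>j \<noteq> v\<close> contributes one factor linear in
  \<open>z\<close>, because a permutation takes the value \<open>j\<close> in a single row. Keeping
  slice \<open>j\<close> throughout gives the constant term; taking slice \<open>v\<close> in all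
  these directions gives the top coefficient.\<close>

lemma tensor_per_merge_slices_poly:
  assumes "finite S" and "v \<notin> S" and "set J \<subseteq> insert v S"
  shows "\<exists>p. (\<forall>z. poly p z = tensor_per S (length J) (\<lambda>i. merge_slices v z J (B i)))
    \<and> degree p \<le> length (filter (\<lambda>j. j \<noteq> v) J)
    \<and> coeff p 0 = tensor_per S (length J) B
    \<and> coeff p (length (filter (\<lambda>j. j \<noteq> v) J)) =
        tensor_per S (length J) (\<lambda>i L. B i (map2 (transpose v) J L))"
  using assms(3)
proof (induction J arbitrary: B)
  case Nil
  show ?case
    by (rule exI[of _ "[:tensor_per S 0 B:]"]) (simp add: tensor_per_0)
next
  case (Cons j J)
  let ?m = "length J"
  define k where "k = length (filter (\<lambda>j. j \<noteq> v) J)"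
  define G where "G C z = tensor_per S ?m (\<lambda>i. merge_slices v z J (C i))" for C z
  define T where "T C = tensor_per S ?m (\<lambda>i L. C i (map2 (transpose v) J L))" for C
  have fin: "finite {\<sigma>. \<sigma> permutes S}"
    using assms(1) by (rule finite_permutations)
  \<comment> \<open>One polynomial is chosen per tensor, since those for all
    \<open>C \<sigma>\<close> and \<open>C' \<sigma>\<close> are to be added up.\<close>
  have "\<forall>C. \<exists>p. (\<forall>z. poly p z = G C z) \<and> degree p \<le> k \<and>
      coeff p 0 = tensor_per S ?m C \<and> coeff p k = T C"
    using Cons.IH Cons.prems unfolding G_def T_def k_def by simp
  then obtain P where P: "\<And>C z. poly (P C) z = G C z" "\<And>C. degree (P C) \<le> k"
      "\<And>C. coeff (P C) 0 = tensor_per S ?m C" "\<And>C. coeff (P C) k = T C"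
    by metis
  define C where "C \<sigma> = (\<lambda>i L. B i (\<sigma> i # L))" for \<sigma> :: "nat \<Rightarrow> nat"
  define C' where "C' \<sigma> = (\<lambda>i L. B i (transpose v j (\<sigma> i) # L))" for \<sigma> :: "nat \<Rightarrow> nat"
  have top: "tensor_per S (length (j # J)) (\<lambda>i L. B i (map2 (transpose v) (j # J) L))
      = (\<Sum>\<sigma> | \<sigma> permutes S. T (C' \<sigma>))"
    by (simp add: tensor_per_Suc T_def C'_def)
  have const: "tensor_per S (length (j # J)) B = (\<Sum>\<sigma> | \<sigma> permutes S. tensor_per S ?m (C \<sigma>))"
    by (simp add: tensor_per_Suc C_def)
  show ?case
  proof (cases "j = v")
    case True
    have "C' = C"
      unfolding C'_def C_def True by simp
    define p where "p = (\<Sum>\<sigma> | \<sigma> permutes S. P (C \<sigma>))"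
    have "poly p z = tensor_per S (length (j # J)) (\<lambda>i. merge_slices v z (j # J) (B i))" for z
      by (simp add: p_def poly_sum P G_def C_def tensor_per_Suc True)
    moreover have "degree p \<le> k"
      unfolding p_def by (intro degree_sum_le fin) (simp add: P)
    moreover have "coeff p 0 = tensor_per S (length (j # J)) B"
      unfolding const by (simp add: p_def coeff_sum P)
    moreover have "coeff p k =
        tensor_per S (length (j # J)) (\<lambda>i L. B i (map2 (transpose v) (j # J) L))"
      unfolding top by (simp add: p_def coeff_sum P \<open>C' = C\<close>)
    ultimately show ?thesis
      using True by (intro exI[of _ p]) (simp add: k_def)
  next
    case False
    then have jS: "j \<in> S"
      using Cons.prems by simp
    \<comment> \<open>\<open>pCons 0\<close> is multiplication by \<open>z\<close>;
      \<open>C' \<sigma>\<close> differs from \<open>C \<sigma>\<close> on \<open>S\<close> only in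
      the row that \<open>\<sigma>\<close> sends to \<open>j\<close>, where it reads slice
      \<open>v\<close>.\<close>
    define p where "p = (\<Sum>\<sigma> | \<sigma> permutes S. P (C \<sigma>) + pCons 0 (P (C' \<sigma>)))"
    have step: "tensor_per S ?m (\<lambda>i L. merge_slices v z (j # J) (B i) (\<sigma> i # L))
        = G (C \<sigma>) z + z * G (C' \<sigma>) z" if \<sigma>: "\<sigma> permutes S" for \<sigma> z
    proof -
      obtain u where u: "u \<in> S" "\<sigma> u = j"
        using jS permutes_image[OF \<sigma>] by (metis imageE)
      have ne: "\<sigma> i \<noteq> j" if "i \<noteq> u" for i
        using permutes_inj[OF \<sigma>] u that by (auto dest: injD)
      have nv: "\<sigma> i \<noteq> v" if "i \<in> S" for i
        using that assms(2) permutes_in_image[OF \<sigma>] by metis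
      show ?thesis
        unfolding G_def C_def C'_def
        by (rule tensor_per_row_linear[OF assms(1) u(1)])
          (use u False ne nv in \<open>auto simp: transpose_def\<close>)
    qed
    have "poly p z = tensor_per S (length (j # J)) (\<lambda>i. merge_slices v z (j # J) (B i))" for z
      unfolding length_Cons tensor_per_Suc p_def poly_sum
      by (intro sum.cong refl) (simp add: step P del: merge_slices.simps)
    moreover have "degree p \<le> Suc k"
      unfolding p_def
      by (intro degree_sum_le fin degree_add_le)
        (auto simp: P le_SucI intro: order_trans[OF degree_pCons_le])
    moreover have "coeff p 0 = tensor_per S (length (j # J)) B"
      unfolding const by (simp add: p_def coeff_sum P)
    \<comment> \<open>Only the shifted summands reach degree \<open>Suc k\<close>.\<close>
    moreover have "coeff (P D) (Suc k) = 0" for D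
      using P(2)[of D] by (intro coeff_eq_0) simp
    then have "coeff p (Suc k) =
        tensor_per S (length (j # J)) (\<lambda>i L. B i (map2 (transpose v) (j # J) L))"
      unfolding top by (simp add: p_def coeff_sum P)
    ultimately show ?thesis
      using False by (intro exI[of _ p]) (simp add: k_def)
  qed
qed

section \<open>Nonvanishing under diagonal dominance\<close>

lemma map2_transpose_replicate: "map2 (transpose v) (replicate (length L) v) L = L"
  by (induction L) auto

lemma tensor_per_diagonally_dominant_nonzero:
  assumes "finite S"
    and "\<And>i. i \<in> S \<Longrightarrow> (\<Sum>L\<in>tuples S m. norm (A i L)) < 1"
  shows "tensor_per S m (\<lambda>i L. of_bool (L = replicate m i) + A i L) \<noteq> 0"
  using assms
proof (induction S arbitrary: A rule: finite_induct)
  case empty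
  have "{\<sigma>. \<sigma> permutes {}} = {id :: nat \<Rightarrow> nat}"
    by auto
  moreover have "tuples {id :: nat \<Rightarrow> nat} m = {replicate m id}"
    by (auto simp: tuples_def intro!: replicate_eqI)
  ultimately show ?case by (simp add: tensor_per_def)
next
  case (insert v S)
  define B where "B i L = of_bool (L = replicate m i) + A i L" for i L
  define N where "N J = tensor_per S m (\<lambda>i L. B i (map2 (transpose v) J L))" for J
  let ?V = "replicate m v" and ?X = "tuples (insert v S) m"
  have NV: "N ?V = tensor_per S m B"
    unfolding N_def
    by (rule tensor_per_cong) (auto simp: tuples_def map2_transpose_replicate)
  \<comment> \<open>The merged tensor is again the unit tensor plus a merged \<open>A\<close> whose
    row sums stay below 1, so the induction hypothesis applies.\<close>
  have merged: "tensor_per S m (\<lambda>i. merge_slices v z J (B i)) \<noteq> 0"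
    if z: "norm z \<le> 1" and J: "J \<in> ?X" for z J
  proof -
    have m: "length J = m"
      using J by (simp add: tuples_def)
    have "(\<Sum>L\<in>tuples S m. norm (merge_slices v z J (A i) L)) < 1" if "i \<in> S" for i
      using sum_norm_merge_slices_le[OF insert.hyps z, of J "A i"] insert.prems[of i] that m
      by simp
    then have "tensor_per S m
        (\<lambda>i L. of_bool (L = replicate m i) + merge_slices v z J (A i) L) \<noteq> 0"
      by (rule insert.IH)
    also have "tensor_per S m (\<lambda>i L. of_bool (L = replicate m i) + merge_slices v z J (A i) L)
        = tensor_per S m (\<lambda>i. merge_slices v z J (B i))"
    proof (rule tensor_per_cong)
      fix i L assume "i \<in> S" "L \<in> tuples S m"
      then have "i \<noteq> v" "length L = length J"
        using insert.hyps(2) m by (auto simp: tuples_def)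
      from merge_slices_diagonal[OF this, of z]
      show "of_bool (L = replicate m i) + merge_slices v z J (A i) L = merge_slices v z J (B i) L"
        by (simp add: B_def[abs_def] merge_slices_add m)
    qed
    finally show ?thesis .
  qed
  have N_le: "norm (N J) \<le> norm (N ?V)" and NV0: "N ?V \<noteq> 0" if J: "J \<in> ?X" for J
  proof -
    have m: "length J = m" and sub: "set J \<subseteq> insert v S"
      using J by (auto simp: tuples_def)
    from tensor_per_merge_slices_poly[OF insert.hyps sub, of B, unfolded m, folded N_def]
    obtain p where p: "\<forall>z. poly p z = tensor_per S m (\<lambda>i. merge_slices v z J (B i))"
        "degree p \<le> length (filter (\<lambda>j. j \<noteq> v) J)" "coeff p 0 = tensor_per S m B"
        "coeff p (length (filter (\<lambda>j. j \<noteq> v) J)) = N J"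
      by (elim exE conjE)
    have nz: "poly p z \<noteq> 0" if "norm z \<le> 1" for z
      using merged[OF that J] p(1) by simp
    show "norm (N J) \<le> norm (N ?V)"
      using norm_coeff_le_norm_constant_coeff[OF nz p(2)] by (simp add: p NV)
    show "N ?V \<noteq> 0"
      using nz[of 0] by (simp add: poly_0_coeff_0 p(3) NV)
  qed
  have VX: "?V \<in> ?X"
    by (auto simp: tuples_def)
  have fin: "finite ?X"
    using insert.hyps by simp
  have "tensor_per (insert v S) m B = (\<Sum>J\<in>?X. B v J * N J)"
    unfolding N_def by (rule tensor_per_row_expansion[OF insert.hyps])
  \<comment> \<open>The unit part of row \<open>v\<close> is supported at \<open>?V\<close>
    alone.\<close>
  also have "\<dots> = (\<Sum>J\<in>?X. if J = ?V then N J else 0) + (\<Sum>J\<in>?X. A v J * N J)"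
    unfolding sum.distrib[symmetric] by (intro sum.cong refl) (simp add: B_def distrib_right)
  also have "(\<Sum>J\<in>?X. if J = ?V then N J else 0) = N ?V"
    using VX fin by simp
  finally have expand: "tensor_per (insert v S) m B = N ?V + (\<Sum>J\<in>?X. A v J * N J)" .
  have "norm (\<Sum>J\<in>?X. A v J * N J) \<le> (\<Sum>J\<in>?X. norm (A v J) * norm (N ?V))"
    by (intro sum_norm_le) (simp add: norm_mult mult_left_mono N_le)
  also have "\<dots> = (\<Sum>J\<in>?X. norm (A v J)) * norm (N ?V)"
    by (simp add: sum_distrib_right)
  \<comment> \<open>Strictness relies on \<open>N ?V \<noteq> 0\<close>; the remaining sum is then
    too small to cancel \<open>N ?V\<close>.\<close>
  also have "\<dots> < 1 * norm (N ?V)"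
    using insert.prems[of v] NV0[OF VX] by (intro mult_strict_right_mono) auto
  finally have "tensor_per (insert v S) m B \<noteq> 0"
    unfolding expand by (auto simp: add_eq_0_iff)
  then show ?case
    by (simp add: B_def[abs_def])
qed

theorem theorem1p5:
  fixes d n :: nat and A :: tensor
  assumes "d \<ge> 2"
    and "\<And>i. i \<in> {1..n} \<Longrightarrow> (\<Sum>js\<in>multi_indices n (d - 1). norm (A (i # js))) < 1"
  shows "PER d n (\<lambda>js. diag_tensor d n js + A js) \<noteq> 0"
proof -
  have "multi_indices n (d - 1) = tuples {1..n} (d - 1)"
    by (auto simp: multi_indices_def tuples_def)
  then have "tensor_per {1..n} (d - 1)
      (\<lambda>i L. of_bool (L = replicate (d - 1) i) + A (i # L)) \<noteq> 0"
    using assms(2) by (intro tensor_per_diagonally_dominant_nonzero) auto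
  moreover have "diag_tensor d n (i # L) = of_bool (L = replicate (d - 1) i)"
    if "i \<in> {1..n}" for i L
    using that assms(1) by (cases d) (auto simp: diag_tensor_def)
  then have "PER d n (\<lambda>js. diag_tensor d n js + A js) = tensor_per {1..n} (d - 1)
      (\<lambda>i L. of_bool (L = replicate (d - 1) i) + A (i # L))"
    unfolding PER_eq_tensor_per by (intro tensor_per_cong) simp
  ultimately show ?thesis by simp
qed

end
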